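(* Let $F=z\,\hat U(x,f)$, $f=c^2\hat Z(x,t)$, be a ${\cal UZ}$-Finsler metric function. Then the determinant $D=\det(g_{ij})$ of its metric tensor is the product $$D=D_1D_2,\qquad D_1=U^4\,U_{ff}\,U_f\,\frac1f,\qquad D_2=Z^3\,Z_{tt},$$ where $U=\hat U(x,f)$, $U_f=\partial\hat U/\partial f$, $U_{ff}=\partial^2\hat U/\partial f^2$, $Z=\hat Z(x,t)$, $Z_{tt}=\partial^2\hat Z/\partial t^2$. The factors possess the property of separation of dependence on the angles $\theta$ and $\phi$, namely $D_1=D_1(x,\theta)$ and $D_2=D_2(x,\phi)$.
   Context: Setting. ${\cal M}$ is a three-dimensional differentiable manifold carrying three vector fields, given through one-forms, linearly independent at each point $x$. At a point $x$, a tangent vector $y$ is described by its components $y^1,y^2,y^3$ with respect to the corresponding basis, and all tensor components are taken with respect to $(y^1,y^2,y^3)$. Put $z=y^3$, $c^1=y^1/z$, $c^2=y^2/z$, $t=y^1/y^2=c^1/c^2$, on the region $z>0$, $y^2>0$. A ${\cal UZ}$-Finsler metric function is a Finsler metric function (sufficiently smooth, positively homogeneous of degree one in $y$) of the form $F=z\,\hat U(x,f)$, $f=c^2\,\hat Z(x,t)$, with $f\ne0$. The metric tensor is $g_{ij}=\frac12\,\partial^2F^2/\partial y^i\partial y^j$. The angles $\theta,\phi$ are variables such that $\theta=\breve\theta(x,f)$ and $\phi=\breve\phi(x,t)$, invertible respectively in $f$ and $t$, so that $f=\breve f(x,\theta)$ and $t=\breve t(x,\phi)$. *)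

theory Defs
  imports "HOL-Analysis.Analysis"
begin

(* Intended for open S. Differentiability at points of S is two-sided (not "within S"). Class k is
   the usual one: all iterated directional derivatives up to order k exist and are continuous. *)
primrec Ck_on :: "nat \<Rightarrow> ('a::real_normed_vector \<Rightarrow> 'b::real_normed_vector) \<Rightarrow> 'a set \<Rightarrow> bool" where
  "Ck_on 0 h S \<longleftrightarrow> continuous_on S h"
| "Ck_on (Suc k) h S \<longleftrightarrow>
     (\<forall>a\<in>S. h differentiable (at a)) \<and> (\<forall>v. Ck_on k (\<lambda>a. frechet_derivative h (at a) v) S)"

subsection \<open>Three-dimensional differentiable manifolds and frames\<close>

type_synonym 'm chart = "'m set \<times> ('m \<Rightarrow> real^3)"

definition transition :: "'m chart \<Rightarrow> 'm chart \<Rightarrow> real^3 \<Rightarrow> real^3" where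
  "transition c d = snd d \<circ> inv_into (fst c) (snd c)"

(* C^1 is the least regularity for which tangent spaces make sense; every C^k or smooth atlas is
   in particular such an atlas. *)
definition differentiable_atlas ::
    "('m::{t2_space, second_countable_topology}) chart set \<Rightarrow> bool" where
  "differentiable_atlas \<A> \<longleftrightarrow>
     (\<Union>c\<in>\<A>. fst c) = UNIV \<and>
     (\<forall>c\<in>\<A>. open (fst c) \<and> open (snd c ` fst c) \<and>
        homeomorphism (fst c) (snd c ` fst c) (snd c) (inv_into (fst c) (snd c))) \<and>
     (\<forall>c\<in>\<A>. \<forall>d\<in>\<A>. Ck_on 1 (transition c d) (snd c ` (fst c \<inter> fst d)))"

(* A tangent vector at x is the family of its coordinate vectors in the charts around x, related by
   the derivatives of the coordinate changes; it is 0 by convention at all other arguments. *)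
type_synonym 'm tangent = "'m chart \<Rightarrow> real^3"

definition tangent_space :: "'m chart set \<Rightarrow> 'm \<Rightarrow> 'm tangent set" where
  "tangent_space \<A> x =
     {Y. (\<forall>c. c \<notin> \<A> \<or> x \<notin> fst c \<longrightarrow> Y c = 0) \<and>
         (\<forall>c\<in>\<A>. \<forall>d\<in>\<A>. x \<in> fst c \<inter> fst d \<longrightarrow>
            Y d = frechet_derivative (transition c d) (at (snd c x)) (Y c))}"

(* The tangent vector at x with components y with respect to the basis E 1 x, E 2 x, E 3 x. *)
definition from_components :: "(3 \<Rightarrow> 'm \<Rightarrow> 'm tangent) \<Rightarrow> 'm \<Rightarrow> real^3 \<Rightarrow> 'm tangent" where
  "from_components E x y = (\<lambda>c. \<Sum>i\<in>UNIV. y $ i *\<^sub>R E i x c)"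

definition components :: "(3 \<Rightarrow> 'm \<Rightarrow> 'm tangent \<Rightarrow> real) \<Rightarrow> 'm \<Rightarrow> 'm tangent \<Rightarrow> real^3" where
  "components \<omega> x Y = (\<chi> i. \<omega> i x Y)"

definition linear_form :: "'m chart set \<Rightarrow> 'm \<Rightarrow> ('m tangent \<Rightarrow> real) \<Rightarrow> bool" where
  "linear_form \<A> x \<alpha> \<longleftrightarrow>
     (\<forall>Y\<in>tangent_space \<A> x. \<forall>Y'\<in>tangent_space \<A> x. \<forall>a b.
        \<alpha> (\<lambda>c. a *\<^sub>R Y c + b *\<^sub>R Y' c) = a * \<alpha> Y + b * \<alpha> Y')"

definition frame_with_forms ::
    "'m chart set \<Rightarrow> (3 \<Rightarrow> 'm \<Rightarrow> 'm tangent \<Rightarrow> real) \<Rightarrow> (3 \<Rightarrow> 'm \<Rightarrow> 'm tangent) \<Rightarrow> bool" where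
  "frame_with_forms \<A> \<omega> E \<longleftrightarrow>
     (\<forall>x. (\<forall>i. E i x \<in> tangent_space \<A> x) \<and>
          (\<forall>a. from_components E x a = (\<lambda>c. 0) \<longrightarrow> a = 0) \<and>
          (\<forall>i. linear_form \<A> x (\<omega> i x)) \<and>
          (\<forall>i j. \<omega> i x (E j x) = (if i = j then 1 else 0)))"

subsection \<open>Metric functions and metric tensors in the frame\<close>

definition in_components ::
    "(3 \<Rightarrow> 'm \<Rightarrow> 'm tangent) \<Rightarrow> ('m \<Rightarrow> 'm tangent \<Rightarrow> real) \<Rightarrow> 'm \<Rightarrow> real^3 \<Rightarrow> real" where
  "in_components E F x y = F x (from_components E x y)"

definition partial :: "3 \<Rightarrow> (real^3 \<Rightarrow> real) \<Rightarrow> real^3 \<Rightarrow> real" where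
  "partial i h y = deriv (\<lambda>s. h (y + s *\<^sub>R axis i 1)) 0"

definition metric_tensor ::
    "(3 \<Rightarrow> 'm \<Rightarrow> 'm tangent) \<Rightarrow> ('m \<Rightarrow> 'm tangent \<Rightarrow> real) \<Rightarrow> 'm \<Rightarrow> real^3 \<Rightarrow> real^3^3" where
  "metric_tensor E F x y =
     (\<chi> i j. 1/2 * partial i (partial j (\<lambda>y'. (in_components E F x y')^2)) y)"

(* C x is the open cone of (components of) admissible tangent vectors at x. Only smoothness in
   the tangent vector is required, of class C^2, which is what the metric tensor needs;
   nothing is assumed about the dependence on x. *)
definition finsler_metric_function ::
    "(3 \<Rightarrow> 'm \<Rightarrow> 'm tangent) \<Rightarrow> ('m \<Rightarrow> (real^3) set) \<Rightarrow> ('m \<Rightarrow> 'm tangent \<Rightarrow> real) \<Rightarrow> bool" where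
  "finsler_metric_function E C F \<longleftrightarrow>
     (\<forall>x. open (C x) \<and> (\<forall>y\<in>C x. \<forall>k>0. k *\<^sub>R y \<in> C x) \<and>
          Ck_on 2 (in_components E F x) (C x) \<and>
          (\<forall>y\<in>C x. \<forall>k>0. in_components E F x (k *\<^sub>R y) = k * in_components E F x y))"

subsection \<open>The UZ form\<close>

definition t_of :: "real^3 \<Rightarrow> real" where
  "t_of y = y $ 1 / y $ 2"

definition f_of :: "('m \<Rightarrow> real \<Rightarrow> real) \<Rightarrow> 'm \<Rightarrow> real^3 \<Rightarrow> real" where
  "f_of Z x y = (y $ 2 / y $ 3) * Z x (t_of y)"

(* The ranges of f and t over the open cone C x are automatically open, because f varies strictly
   monotonically with y^3 (f is never 0) and t with y^1. *)
definition UZ_finsler ::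
    "'m chart set \<Rightarrow> (3 \<Rightarrow> 'm \<Rightarrow> 'm tangent \<Rightarrow> real) \<Rightarrow> (3 \<Rightarrow> 'm \<Rightarrow> 'm tangent) \<Rightarrow>
     ('m \<Rightarrow> (real^3) set) \<Rightarrow> ('m \<Rightarrow> 'm tangent \<Rightarrow> real) \<Rightarrow>
     ('m \<Rightarrow> real \<Rightarrow> real) \<Rightarrow> ('m \<Rightarrow> real \<Rightarrow> real) \<Rightarrow> bool" where
  "UZ_finsler \<A> \<omega> E C F U Z \<longleftrightarrow>
     finsler_metric_function E C F \<and>
     (\<forall>x. (\<forall>y\<in>C x. y $ 3 > 0 \<and> y $ 2 > 0 \<and> f_of Z x y \<noteq> 0) \<and>
          Ck_on 2 (U x) (f_of Z x ` C x) \<and> Ck_on 2 (Z x) (t_of ` C x) \<and>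
          (\<forall>Y\<in>tangent_space \<A> x. components \<omega> x Y \<in> C x \<longrightarrow>
             F x Y = components \<omega> x Y $ 3 * U x (f_of Z x (components \<omega> x Y))))"

definition D1 :: "('m \<Rightarrow> real \<Rightarrow> real) \<Rightarrow> 'm \<Rightarrow> real \<Rightarrow> real" where
  "D1 U x f = (U x f)^4 * deriv (deriv (U x)) f * deriv (U x) f * (1 / f)"

definition D2 :: "('m \<Rightarrow> real \<Rightarrow> real) \<Rightarrow> 'm \<Rightarrow> real \<Rightarrow> real" where
  "D2 Z x t = (Z x t)^3 * deriv (deriv (Z x)) t"

end

theory Submission
  imports Defs
begin

text \<open>
  In frame components the metric function is \<open>F = z U(f)\<close> with \<open>f = w / z\<close> and
  \<open>w = y\<^sub>2 Z(t)\<close>, where \<open>t = y\<^sub>1 / y\<^sub>2\<close>: a function homogeneous of degree one in \<open>(w, z)\<close>,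
  in which \<open>w\<close> is itself homogeneous of degree one in \<open>(y\<^sub>1, y\<^sub>2)\<close>. Every function that occurs when
  \<open>F\<^sup>2\<close> is differentiated once is of the separated form \<open>z\<^sup>k A(f) B(t)\<close>, so one rule for the partial
  derivatives of such functions (\<open>partial_separated\<close>), used twice, yields the metric tensor.

  Put \<open>g = U U'\<close>, let \<open>g'\<close> be its derivative at \<open>f\<close>, and put \<open>b = Z'\<close>, \<open>m = Z - t Z'\<close>,
  \<open>r = g - f g'\<close>, \<open>s = U\<^sup>2 - f g - f r\<close> and \<open>q = z g Z'' / y\<^sub>2\<close>. With the covectors \<open>\<alpha> = (b, m, 0)\<close>,
  \<open>\<gamma> = (0, 0, 1)\<close> and \<open>\<beta> = (1, -t, 0)\<close>, the metric tensor at \<open>y\<close>, as a quadratic form, is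
  \<open>g' \<alpha>\<^sup>2 + 2 r \<alpha> \<gamma> + s \<gamma>\<^sup>2 + q \<beta>\<^sup>2\<close>. Hence its determinant is \<open>q (g' s - r\<^sup>2)\<close> times the square of
  \<open>det (\<alpha>, \<beta>, \<gamma>) = - (m + t b)\<close>. Here \<open>m + t b = Z\<close>, the bracket \<open>g' s - r\<^sup>2\<close> collapses to
  \<open>U\<^sup>3 U''\<close>, and \<open>z / y\<^sub>2 = Z / f\<close> removes the last mixed quantity from \<open>q\<close>; what is left splits
  into a function of \<open>f\<close> and a function of \<open>t\<close> (\<open>det_metric_tensor_UZ\<close>).

  Since \<open>\<theta>\<close> determines \<open>f\<close> and \<open>\<phi>\<close> determines \<open>t\<close>, these two functions depend on the respective
  angle only.
\<close>

section \<open>Components with respect to the frame\<close>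

lemma transition_differentiable:
  assumes "differentiable_atlas \<A>" "c \<in> \<A>" "d \<in> \<A>" "x \<in> fst c \<inter> fst d"
  shows "transition c d differentiable at (snd c x)"
proof -
  have "Ck_on 1 (transition c d) (snd c ` (fst c \<inter> fst d))"
    using assms(1-3) unfolding differentiable_atlas_def by blast
  then show ?thesis
    using assms(4) by auto
qed

text \<open>
  The coordinate vectors of a tangent vector transform by derivatives of transition maps; these
  are linear because the transition maps are differentiable.
\<close>

lemma tangent_space_lincomb:
  assumes "differentiable_atlas \<A>" and Y: "Y \<in> tangent_space \<A> x" "Y' \<in> tangent_space \<A> x"
  shows "(\<lambda>c. a *\<^sub>R Y c + b *\<^sub>R Y' c) \<in> tangent_space \<A> x"
proof -
  have "a *\<^sub>R Y d + b *\<^sub>R Y' d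
          = frechet_derivative (transition c d) (at (snd c x)) (a *\<^sub>R Y c + b *\<^sub>R Y' c)"
    if cd: "c \<in> \<A>" "d \<in> \<A>" "x \<in> fst c \<inter> fst d" for c d
  proof -
    have "linear (frechet_derivative (transition c d) (at (snd c x)))"
      using transition_differentiable[OF assms(1) cd] by (rule linear_frechet_derivative)
    moreover have "Y d = frechet_derivative (transition c d) (at (snd c x)) (Y c)"
      "Y' d = frechet_derivative (transition c d) (at (snd c x)) (Y' c)"
      using Y cd unfolding tangent_space_def by blast+
    ultimately show ?thesis
      by (simp add: linear_add linear_scale)
  qed
  moreover have "a *\<^sub>R Y c + b *\<^sub>R Y' c = 0" if "c \<notin> \<A> \<or> x \<notin> fst c" for c
  proof -
    have "Y c = 0" "Y' c = 0"
      using Y that unfolding tangent_space_def by blast+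
    then show ?thesis by simp
  qed
  ultimately show ?thesis
    unfolding tangent_space_def by blast
qed

text \<open>
  The metric function is given in terms of the values of the one-forms, the metric tensor in terms
  of coefficients with respect to the frame. Duality identifies the two, but the one-forms are
  linear on tangent vectors only, so one has to stay inside the tangent space.
\<close>

lemma components_from_components:
  assumes "differentiable_atlas \<A>" and frame: "frame_with_forms \<A> \<omega> E"
  shows "from_components E x y \<in> tangent_space \<A> x"
    and "components \<omega> x (from_components E x y) = y"
proof -
  have E: "E i x \<in> tangent_space \<A> x" and \<omega>: "linear_form \<A> x (\<omega> i x)"
    and dual: "\<omega> i x (E j x) = (if i = j then 1 else 0)" for i j
    using frame unfolding frame_with_forms_def by blast+
  have lin: "\<omega> i x (\<lambda>c. a *\<^sub>R Y c + b *\<^sub>R Y' c) = a * \<omega> i x Y + b * \<omega> i x Y'"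
    if "Y \<in> tangent_space \<A> x" "Y' \<in> tangent_space \<A> x" for i Y Y' a b
    using \<omega>[of i] that unfolding linear_form_def by blast
  define Y where "Y = (\<lambda>c. y$1 *\<^sub>R E 1 x c + y$2 *\<^sub>R E 2 x c)"
  have Y: "Y \<in> tangent_space \<A> x"
    unfolding Y_def by (intro tangent_space_lincomb assms E)
  have eq: "from_components E x y = (\<lambda>c. 1 *\<^sub>R Y c + y$3 *\<^sub>R E 3 x c)"
    unfolding from_components_def Y_def by (simp add: sum_3)
  show "from_components E x y \<in> tangent_space \<A> x"
    unfolding eq by (intro tangent_space_lincomb assms E Y)
  have "\<omega> i x (from_components E x y) = y $ i" for i
  proof -
    have "\<omega> i x (from_components E x y) = \<omega> i x Y + y$3 * \<omega> i x (E 3 x)"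
      unfolding eq using lin[OF Y E[of 3], of i 1 "y$3"] by simp
    also have "\<omega> i x Y = y$1 * \<omega> i x (E 1 x) + y$2 * \<omega> i x (E 2 x)"
      unfolding Y_def by (rule lin) (rule E)+
    finally show ?thesis
      using exhaust_3[of i] by (auto simp: dual)
  qed
  then show "components \<omega> x (from_components E x y) = y"
    by (simp add: components_def vec_eq_iff)
qed

section \<open>Ranges of \<open>f\<close> and \<open>t\<close>, and one-variable derivatives\<close>

text \<open>
  Second derivatives at a point of the range of \<open>f\<close> or \<open>t\<close> need the first derivative in a whole
  neighbourhood, so both ranges have to be open. Continuous local right inverses through each point
  give this: close to \<open>\<phi> y\<close> they take values in the open set.
\<close>

lemma open_image_if_local_section:
  fixes \<phi> :: "'a::topological_space \<Rightarrow> 'b::t2_space"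
  assumes "open C"
    and "\<And>y. y \<in> C \<Longrightarrow> \<exists>\<sigma>. isCont \<sigma> (\<phi> y) \<and> \<sigma> (\<phi> y) = y \<and> (\<forall>\<^sub>F s in nhds (\<phi> y). \<phi> (\<sigma> s) = s)"
  shows "open (\<phi> ` C)"
proof -
  have "\<forall>\<^sub>F s in nhds a. s \<in> \<phi> ` C" if a: "a \<in> \<phi> ` C" for a
  proof -
    obtain y where y: "y \<in> C" "a = \<phi> y" using a by blast
    obtain \<sigma> where \<sigma>: "isCont \<sigma> (\<phi> y)" "\<sigma> (\<phi> y) = y" "\<forall>\<^sub>F s in nhds (\<phi> y). \<phi> (\<sigma> s) = s"
      using assms(2)[OF y(1)] by blast
    have "(\<sigma> \<longlongrightarrow> \<sigma> (\<phi> y)) (nhds (\<phi> y))"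
      using \<sigma>(1) unfolding isCont_def tendsto_at_iff_tendsto_nhds .
    then have "\<forall>\<^sub>F s in nhds (\<phi> y). \<sigma> s \<in> C"
      by (rule topological_tendstoD) (simp_all add: assms(1) y(1) \<sigma>(2))
    with \<sigma>(3) have "\<forall>\<^sub>F s in nhds (\<phi> y). s \<in> \<phi> ` C"
      by eventually_elim force
    then show ?thesis by (simp add: y(2))
  qed
  then show ?thesis
    by (subst open_subopen) (simp add: eventually_nhds subset_eq)
qed

lemma open_f_range:
  assumes "open C" and pos: "\<And>y. y \<in> C \<Longrightarrow> y $ 3 > 0 \<and> f_of Z x y \<noteq> 0"
  shows "open (f_of Z x ` C)"
proof (rule open_image_if_local_section[OF assms(1)])
  fix y assume y: "y \<in> C"
  define w where "w = y$2 * Z x (t_of y)"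
  \<comment> \<open>Moving only the third component keeps \<open>t\<close> and hence \<open>w\<close> fixed, so \<open>f = w / z\<close> can be solved for \<open>z\<close>.\<close>
  define \<sigma> where "\<sigma> s = y + (w / s - y$3) *\<^sub>R axis 3 1" for s
  have f: "f_of Z x y = w / y$3" and nz: "y$3 > 0" "f_of Z x y \<noteq> 0"
    using pos[OF y] by (simp_all add: f_of_def w_def)
  have w: "w \<noteq> 0" using nz f by auto
  have sel: "\<sigma> s $ 1 = y$1" "\<sigma> s $ 2 = y$2" "\<sigma> s $ 3 = w / s" for s
    by (simp_all add: \<sigma>_def axis_def)
  have inv: "f_of Z x (\<sigma> s) = s" if "s \<noteq> 0" for s
    using that w by (simp add: f_of_def t_of_def sel) (simp add: w_def t_of_def)
  have "isCont \<sigma> (f_of Z x y)"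
    unfolding \<sigma>_def using nz by (intro continuous_intros)
  moreover have "\<sigma> (f_of Z x y) = y"
    using nz w by (simp add: \<sigma>_def f)
  moreover have "\<forall>\<^sub>F s in nhds (f_of Z x y). f_of Z x (\<sigma> s) = s"
    using t1_space_nhds[OF nz(2)] by (rule eventually_mono) (rule inv)
  ultimately show "\<exists>\<sigma>. isCont \<sigma> (f_of Z x y) \<and> \<sigma> (f_of Z x y) = y \<and>
      (\<forall>\<^sub>F s in nhds (f_of Z x y). f_of Z x (\<sigma> s) = s)"
    by blast
qed

lemma open_t_range:
  assumes "open C" and pos: "\<And>y. y \<in> C \<Longrightarrow> y $ 2 > 0"
  shows "open (t_of ` C)"
proof (rule open_image_if_local_section[OF assms(1)])
  fix y assume y: "y \<in> C"
  define \<sigma> where "\<sigma> s = y + (s * y$2 - y$1) *\<^sub>R axis 1 1" for s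
  have nz: "y$2 > 0"
    using pos[OF y] .
  have sel: "\<sigma> s $ 1 = s * y$2" "\<sigma> s $ 2 = y$2" for s
    by (simp_all add: \<sigma>_def axis_def)
  have "t_of (\<sigma> s) = s" for s
    using nz by (simp add: t_of_def sel)
  moreover have "isCont \<sigma> (t_of y)"
    unfolding \<sigma>_def by (intro continuous_intros)
  moreover have "\<sigma> (t_of y) = y"
    using nz by (simp add: \<sigma>_def t_of_def)
  ultimately show "\<exists>\<sigma>. isCont \<sigma> (t_of y) \<and> \<sigma> (t_of y) = y \<and> (\<forall>\<^sub>F s in nhds (t_of y). t_of (\<sigma> s) = s)"
    by auto
qed

text \<open>
  \<^const>\<open>Ck_on\<close> speaks about Frechet derivatives. These agree with \<^const>\<open>deriv\<close> where the
  function is differentiable, hence near every point of an open set, and so may be exchanged under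
  a further derivative.
\<close>

lemma Ck_on_2_real_derivatives:
  fixes h :: "real \<Rightarrow> real"
  assumes "Ck_on 2 h S" "open S" "a \<in> S"
  shows "(h has_real_derivative deriv h a) (at a)"
    and "(deriv h has_real_derivative deriv (deriv h) a) (at a)"
proof -
  have diff: "h differentiable (at b)" if "b \<in> S" for b
    using assms(1) that by (simp add: numeral_2_eq_2)
  have "(\<lambda>b. frechet_derivative h (at b) 1) differentiable (at a)"
    using assms(1,3) by (simp add: numeral_2_eq_2)
  moreover have "\<forall>\<^sub>F b in nhds a. frechet_derivative h (at b) 1 = deriv h b"
  proof -
    have "frechet_derivative h (at b) 1 = deriv h b" if "b \<in> S" for b
    proof -
      have "(h has_real_derivative deriv h b) (at b)"
        using diff[OF that] by (simp add: DERIV_deriv_iff_real_differentiable)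
      then have "(h has_derivative (*) (deriv h b)) (at b)"
        by (simp add: has_field_derivative_def)
      then have "frechet_derivative h (at b) = (*) (deriv h b)"
        by (metis frechet_derivative_at)
      then show ?thesis by simp
    qed
    then show ?thesis
      using assms(2,3) by (auto simp: eventually_nhds)
  qed
  ultimately obtain D where "((\<lambda>b. frechet_derivative h (at b) 1) has_real_derivative D) (at a)"
    by (meson real_differentiable_def)
  then have "(deriv h has_real_derivative D) (at a)"
    using \<open>\<forall>\<^sub>F b in nhds a. _ b = _ b\<close> by (subst (asm) DERIV_cong_ev[OF refl _ refl])
  then show "(deriv h has_real_derivative deriv (deriv h) a) (at a)"
    by (metis DERIV_imp_deriv)
  show "(h has_real_derivative deriv h a) (at a)"
    using diff[OF assms(3)] by (simp add: DERIV_deriv_iff_real_differentiable)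
qed

section \<open>Partial derivatives of separated functions\<close>

lemma partial_cong_open:
  assumes "open S" "y \<in> S" "\<And>v. v \<in> S \<Longrightarrow> h v = k v"
  shows "partial i h y = partial i k y"
proof -
  define p where "p s = y + s *\<^sub>R axis i 1" for s :: real
  have "isCont p 0"
    unfolding p_def by (intro continuous_intros)
  then have "(p \<longlongrightarrow> p 0) (nhds 0)"
    unfolding isCont_def tendsto_at_iff_tendsto_nhds .
  then have "\<forall>\<^sub>F s in nhds 0. p s \<in> S"
    by (rule topological_tendstoD) (simp_all add: assms(1,2) p_def)
  then have "\<forall>\<^sub>F s in nhds 0. h (y + s *\<^sub>R axis i 1) = k (y + s *\<^sub>R axis i 1)"
    unfolding p_def by (rule eventually_mono) (rule assms(3))
  then show ?thesis
    unfolding partial_def by (rule deriv_cong_ev) simp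
qed

text \<open>
  The chain rule with \<open>df = (Z', Z - t Z', - f) / z\<close> and \<open>dt = (1, - t, 0) / y\<^sub>2\<close>. Taking general
  factors \<open>A\<close> and \<open>B\<close> makes the rule apply both to \<open>F\<^sup>2\<close> and to its first partial derivatives.
\<close>

lemma partial_separated:
  fixes A B :: "real \<Rightarrow> real" and Z :: "'m \<Rightarrow> real \<Rightarrow> real" and x :: 'm and y :: "real^3"
  defines "t \<equiv> t_of y" and "f \<equiv> f_of Z x y"
  assumes z: "y$3 > 0" and y2: "y$2 > 0"
    and dZ: "(Z x has_real_derivative Z') (at t)"
    and dA: "(A has_real_derivative A') (at f)"
    and dB: "(B has_real_derivative B') (at t)"
  shows "partial 1 (\<lambda>v. (v$3)^k * A (f_of Z x v) * B (t_of v)) y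
           = (y$3)^k * (A' * (Z' / y$3) * B t + A f * B' / y$2)" (is ?P1)
    and "partial 2 (\<lambda>v. (v$3)^k * A (f_of Z x v) * B (t_of v)) y
           = (y$3)^k * (A' * ((Z x t - t * Z') / y$3) * B t - A f * B' * t / y$2)" (is ?P2)
    and "partial 3 (\<lambda>v. (v$3)^k * A (f_of Z x v) * B (t_of v)) y
           = (y$3)^k * (real k * A f - A' * f) * B t / y$3" (is ?P3)
proof -
  \<comment> \<open>The derivative along a direction \<open>e\<close> with third component \<open>c\<close>, in terms of those of \<open>t\<close> and \<open>f\<close>.\<close>
  have line: "((\<lambda>s. (y$3 + s * c)^k * A (f_of Z x (y + s *\<^sub>R e)) * B (t_of (y + s *\<^sub>R e)))
      has_real_derivative (real k * (y$3)^(k-1) * c * A f * B t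
         + (y$3)^k * (A' * f') * B t + (y$3)^k * A f * (B' * t'))) (at 0)"
    if "((\<lambda>s. t_of (y + s *\<^sub>R e)) has_real_derivative t') (at 0)"
       "((\<lambda>s. f_of Z x (y + s *\<^sub>R e)) has_real_derivative f') (at 0)" for e :: "real^3" and c t' f'
  proof -
    have a: "((\<lambda>s. A (f_of Z x (y + s *\<^sub>R e))) has_real_derivative A' * f') (at 0)"
      using dA that(2) by (intro DERIV_chain2[where f = A]) (simp_all add: f_def)
    have b: "((\<lambda>s. B (t_of (y + s *\<^sub>R e))) has_real_derivative B' * t') (at 0)"
      using dB that(1) by (intro DERIV_chain2[where f = B]) (simp_all add: t_def)
    show ?thesis
      by (rule derivative_eq_intros a b refl | simp add: t_def f_def)+ (simp add: algebra_simps)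
  qed
  have dt: "((\<lambda>s. t_of (y + s *\<^sub>R axis 1 1)) has_real_derivative 1 / y$2) (at 0)"
    "((\<lambda>s. t_of (y + s *\<^sub>R axis 2 1)) has_real_derivative - t / y$2) (at 0)"
    "((\<lambda>s. t_of (y + s *\<^sub>R axis 3 1)) has_real_derivative 0) (at 0)"
    using y2 unfolding t_of_def t_def
    by (auto simp: axis_def power2_eq_square divide_simps intro!: derivative_eq_intros)
  have dZt: "((\<lambda>s. Z x (t_of (y + s *\<^sub>R e))) has_real_derivative Z' * t') (at 0)"
    if "((\<lambda>s. t_of (y + s *\<^sub>R e)) has_real_derivative t') (at 0)" for e t'
    using dZ that by (intro DERIV_chain2[where f = "Z x"]) (simp_all add: t_def)
  note dZ' = dt[THEN dZt]
  have df: "((\<lambda>s. f_of Z x (y + s *\<^sub>R axis 1 1)) has_real_derivative Z' / y$3) (at 0)"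
    "((\<lambda>s. f_of Z x (y + s *\<^sub>R axis 2 1)) has_real_derivative (Z x t - t * Z') / y$3) (at 0)"
    "((\<lambda>s. f_of Z x (y + s *\<^sub>R axis 3 1)) has_real_derivative - f / y$3) (at 0)"
  proof -
    have "f_of Z x (y + s *\<^sub>R axis 1 1) = y$2 / y$3 * Z x (t_of (y + s *\<^sub>R axis 1 1))"
      "f_of Z x (y + s *\<^sub>R axis 2 1) = (y$2 + s) / y$3 * Z x (t_of (y + s *\<^sub>R axis 2 1))"
      "f_of Z x (y + s *\<^sub>R axis 3 1) = y$2 / (y$3 + s) * Z x (t_of (y + s *\<^sub>R axis 3 1))" for s
      by (simp_all add: f_of_def axis_def)
    note line_f = this
    show "((\<lambda>s. f_of Z x (y + s *\<^sub>R axis 1 1)) has_real_derivative Z' / y$3) (at 0)"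
      unfolding line_f by (rule DERIV_cmult[OF dZ'(1), THEN DERIV_cong]) (use y2 in simp)
    have "((\<lambda>s. (y$2 + s) / y$3) has_real_derivative 1 / y$3) (at 0)"
      using z by (auto intro!: derivative_eq_intros)
    from DERIV_mult[OF this dZ'(2)]
    show "((\<lambda>s. f_of Z x (y + s *\<^sub>R axis 2 1)) has_real_derivative (Z x t - t * Z') / y$3) (at 0)"
      unfolding line_f by (rule DERIV_cong) (use y2 z in \<open>simp add: t_def field_simps\<close>)
    have "((\<lambda>s. y$2 / (y$3 + s)) has_real_derivative - (y$2 / (y$3)^2)) (at 0)"
      using z by (auto intro!: derivative_eq_intros simp: power2_eq_square)
    from DERIV_mult[OF this dZ'(3)]
    show "((\<lambda>s. f_of Z x (y + s *\<^sub>R axis 3 1)) has_real_derivative - f / y$3) (at 0)"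
      unfolding line_f by (rule DERIV_cong) (use z in \<open>simp add: f_def f_of_def t_def power2_eq_square\<close>)
  qed
  show ?P1
    using line[OF dt(1) df(1), of 0, THEN DERIV_imp_deriv] unfolding partial_def
    by (simp add: axis_def algebra_simps)
  show ?P2
    using line[OF dt(2) df(2), of 0, THEN DERIV_imp_deriv] unfolding partial_def
    by (simp add: axis_def algebra_simps)
  have pow: "real k * (y$3)^(k-1) = real k * (y$3)^k / y$3"
    using z by (cases k) simp_all
  have "partial 3 (\<lambda>v. (v$3)^k * A (f_of Z x v) * B (t_of v)) y
      = real k * (y$3)^(k-1) * A f * B t - (y$3)^k * A' * f * B t / y$3"
    using line[OF dt(3) df(3), of 1, THEN DERIV_imp_deriv] unfolding partial_def
    by (simp add: axis_def)
  then show ?P3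
    unfolding pow using z by (simp add: field_simps)
qed

section \<open>The metric tensor and its determinant\<close>

text \<open>
  With \<open>G = U U'\<close> and \<open>m = Z - t Z'\<close> the differential of \<open>F\<^sup>2\<close> is
  \<open>2 z (G Z', G m, U\<^sup>2 - f G)\<close>, and differentiating once more gives the six components of the metric
  tensor. Its determinant is affine in the coefficient \<open>q\<close> of \<open>Z''\<close>, with vanishing constant term,
  because the remaining part of the tensor has rank at most two.
\<close>

lemma det_metric_tensor_UZ:
  assumes "open C"
    and pos: "\<And>v. v \<in> C \<Longrightarrow> v$3 > 0 \<and> v$2 > 0 \<and> f_of Z x v \<noteq> 0"
    and U: "Ck_on 2 (U x) (f_of Z x ` C)" and Z: "Ck_on 2 (Z x) (t_of ` C)"
    and F: "\<And>v. v \<in> C \<Longrightarrow> in_components E F x v = v$3 * U x (f_of Z x v)"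
    and y: "y \<in> C"
  shows "det (metric_tensor E F x y) = D1 U x (f_of Z x y) * D2 Z x (t_of y)"
proof -
  let ?f = "f_of Z x" and ?u = "U x" and ?\<zeta> = "Z x"
  let ?u' = "deriv ?u" and ?\<zeta>' = "deriv ?\<zeta>"
  define G where "G s = ?u s * ?u' s" for s
  \<comment> \<open>\<open>H = U\<^sup>2 - f G\<close>, the third component of half the differential of \<open>F\<^sup>2\<close>, divided by \<open>z\<close>.\<close>
  define H where "H s = ?u s * (?u s - s * ?u' s)" for s
  define m where "m s = ?\<zeta> s - s * ?\<zeta>' s" for s
  have openf: "open (?f ` C)" and opent: "open (t_of ` C)"
    by (rule open_f_range open_t_range, rule assms(1), simp add: pos)+
  note dU = Ck_on_2_real_derivatives[OF U openf imageI]
  note dZ = Ck_on_2_real_derivatives[OF Z opent imageI]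
  have dconst: "((\<lambda>_. 1) has_real_derivative 0) (at s)" for s :: real
    by simp
  have dU2: "((\<lambda>s. ?u s ^ 2) has_real_derivative 2 * G (?f v)) (at (?f v))" if "v \<in> C" for v
    unfolding G_def by (rule derivative_eq_intros dU(1)[OF that] refl | simp)+
  have dG: "(G has_real_derivative ?u' (?f v) ^ 2 + ?u (?f v) * deriv ?u' (?f v)) (at (?f v))"
    if "v \<in> C" for v
    unfolding G_def
    by (rule derivative_eq_intros dU[OF that] refl | simp add: power2_eq_square)+
  have dH: "(H has_real_derivative
      G (?f v) - ?f v * (?u' (?f v) ^ 2 + ?u (?f v) * deriv ?u' (?f v))) (at (?f v))"
    if "v \<in> C" for v
    unfolding H_def G_def
    by (rule derivative_eq_intros dU[OF that] refl | simp)+ (simp add: algebra_simps power2_eq_square)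
  have dm: "(m has_real_derivative - t_of v * deriv ?\<zeta>' (t_of v)) (at (t_of v))" if "v \<in> C" for v
    unfolding m_def by (rule derivative_eq_intros dZ[OF that] refl | simp)+
  let ?F2 = "\<lambda>v. (in_components E F x v)^2"
  have first: "partial 1 ?F2 v = (v$3)^1 * (2 * G (?f v)) * ?\<zeta>' (t_of v)"
      "partial 2 ?F2 v = (v$3)^1 * (2 * G (?f v)) * m (t_of v)"
      "partial 3 ?F2 v = (v$3)^1 * (2 * H (?f v)) * 1" if v: "v \<in> C" for v
  proof -
    have sq: "partial i ?F2 v = partial i (\<lambda>v. (v$3)^2 * ?u (?f v) ^ 2 * 1) v" for i
      by (rule partial_cong_open[OF assms(1) v]) (simp add: F power_mult_distrib)
    have z: "v$3 > 0" "v$2 > 0"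
      using pos[OF v] by auto
    note sep = partial_separated[where k=2 and Z=Z and x=x and y=v, OF z dZ(1)[OF v] dU2[OF v] dconst]
    show "partial 1 ?F2 v = (v$3)^1 * (2 * G (?f v)) * ?\<zeta>' (t_of v)"
      "partial 2 ?F2 v = (v$3)^1 * (2 * G (?f v)) * m (t_of v)"
      "partial 3 ?F2 v = (v$3)^1 * (2 * H (?f v)) * 1"
      unfolding sq sep using z by (simp_all add: G_def H_def m_def field_simps power2_eq_square)
  qed
  let ?z = "y$3" and ?y2 = "y$2" and ?t = "t_of y"
  define f where "f = ?f y"
  define g where "g = G f"
  define g' where "g' = ?u' f ^ 2 + ?u f * deriv ?u' f"
  have nz: "?z > 0" "?y2 > 0" "f \<noteq> 0"
    using pos[OF y] by (auto simp: f_def)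
  have dG2: "((\<lambda>s. 2 * G s) has_real_derivative 2 * g') (at (?f y))"
    using DERIV_cmult[OF dG[OF y], of 2] by (simp add: g'_def f_def)
  have dH2: "((\<lambda>s. 2 * H s) has_real_derivative 2 * (g - f * g')) (at (?f y))"
    using DERIV_cmult[OF dH[OF y], of 2] by (simp add: g_def g'_def f_def)
  define q where "q = ?z * g * deriv ?\<zeta>' ?t / ?y2"
  let ?M = "metric_tensor E F x y"
  have M: "?M $ i $ j = 1/2 * partial i (partial j ?F2) y" for i j
    by (simp add: metric_tensor_def)
  have c: "partial i (partial 1 ?F2) y = partial i (\<lambda>v. (v$3)^1 * (2 * G (?f v)) * ?\<zeta>' (t_of v)) y"
    "partial i (partial 2 ?F2) y = partial i (\<lambda>v. (v$3)^1 * (2 * G (?f v)) * m (t_of v)) y"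
    "partial i (partial 3 ?F2) y = partial i (\<lambda>v. (v$3)^1 * (2 * H (?f v)) * 1) y" for i
    by (rule partial_cong_open[OF assms(1) y], erule first)+
  note second = partial_separated[where k=1 and Z=Z and x=x and y=y, OF nz(1,2) dZ(1)[OF y]]
  note col = second[OF dG2 dZ(2)[OF y]] second[OF dG2 dm[OF y]] second[OF dH2 dconst]
  let ?b = "?\<zeta>' ?t" and ?m = "m ?t"
  have col1: "?M$1$1 = g' * ?b^2 + q" "?M$2$1 = g' * ?b * ?m - q * ?t" "?M$3$1 = (g - f * g') * ?b"
    unfolding M c col using nz by (simp_all add: q_def g_def f_def m_def field_simps power2_eq_square)
  have col2: "?M$1$2 = g' * ?b * ?m - q * ?t" "?M$2$2 = g' * ?m^2 + q * ?t^2" "?M$3$2 = (g - f * g') * ?m"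
    unfolding M c col using nz by (simp_all add: q_def g_def f_def m_def field_simps power2_eq_square)
  have col3: "?M$1$3 = (g - f * g') * ?b" "?M$2$3 = (g - f * g') * ?m"
    "?M$3$3 = H f - f * (g - f * g')"
    unfolding M c col using nz by (simp_all add: g_def f_def m_def field_simps power2_eq_square)
  \<comment> \<open>Other than through \<open>f\<close> and \<open>t\<close>, \<open>y\<close> enters only by the quotient \<open>z / y\<^sub>2\<close> in \<open>q\<close>; \<open>f = y\<^sub>2 Z / z\<close> turns it into \<open>Z / f\<close>.\<close>
  have zf: "?z / ?y2 = ?\<zeta> ?t / f"
    using nz by (simp add: f_def f_of_def field_simps)
  have euler: "?m + ?t * ?b = ?\<zeta> ?t"
    by (simp add: m_def)
  have block: "g' * (H f - f * (g - f * g')) - (g - f * g')^2 = ?u f ^ 3 * deriv ?u' f"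
    unfolding g_def g'_def G_def H_def by algebra
  have "det ?M = q * (?m + ?t * ?b)^2 * (g' * (H f - f * (g - f * g')) - (g - f * g')^2)"
    unfolding det_3 col1 col2 col3 by algebra
  also have "\<dots> = q * ?\<zeta> ?t ^ 2 * (?u f ^ 3 * deriv ?u' f)"
    unfolding euler block ..
  also have "q = g * deriv ?\<zeta>' ?t * (?\<zeta> ?t / f)"
    unfolding zf[symmetric] by (simp add: q_def)
  also have "\<dots> * ?\<zeta> ?t ^ 2 * (?u f ^ 3 * deriv ?u' f) = D1 U x f * D2 Z x ?t"
    by (simp add: D1_def D2_def g_def G_def power2_eq_square power3_eq_cube power4_eq_xxxx)
  finally show ?thesis
    unfolding f_def .
qed

theorem proposition3p2:
  fixes \<A> :: "('m::{t2_space, second_countable_topology}) chart set"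
    and \<omega> :: "3 \<Rightarrow> 'm \<Rightarrow> 'm tangent \<Rightarrow> real"
    and E :: "3 \<Rightarrow> 'm \<Rightarrow> 'm tangent"
    and C :: "'m \<Rightarrow> (real^3) set"
    and F :: "'m \<Rightarrow> 'm tangent \<Rightarrow> real"
    and U Z :: "'m \<Rightarrow> real \<Rightarrow> real"
    and theta phi f_inv t_inv :: "'m \<Rightarrow> real \<Rightarrow> real"
  assumes "differentiable_atlas \<A>"
    and "frame_with_forms \<A> \<omega> E"
    and "UZ_finsler \<A> \<omega> E C F U Z"
    and "\<And>x f. f \<in> f_of Z x ` C x \<Longrightarrow> f_inv x (theta x f) = f"
    and "\<And>x t. t \<in> t_of ` C x \<Longrightarrow> t_inv x (phi x t) = t"
  shows "(\<forall>x. \<forall>y\<in>C x.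
            det (metric_tensor E F x y) = D1 U x (f_of Z x y) * D2 Z x (t_of y)) \<and>
         (\<exists>\<Delta>1 \<Delta>2 :: 'm \<Rightarrow> real \<Rightarrow> real. \<forall>x. \<forall>y\<in>C x.
            D1 U x (f_of Z x y) = \<Delta>1 x (theta x (f_of Z x y)) \<and>
            D2 Z x (t_of y) = \<Delta>2 x (phi x (t_of y)))"
proof -
  have UZ: "finsler_metric_function E C F"
    "\<And>x y. y \<in> C x \<Longrightarrow> y $ 3 > 0 \<and> y $ 2 > 0 \<and> f_of Z x y \<noteq> 0"
    "\<And>x. Ck_on 2 (U x) (f_of Z x ` C x)" "\<And>x. Ck_on 2 (Z x) (t_of ` C x)"
    "\<And>x Y. Y \<in> tangent_space \<A> x \<Longrightarrow> components \<omega> x Y \<in> C x \<Longrightarrow>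
       F x Y = components \<omega> x Y $ 3 * U x (f_of Z x (components \<omega> x Y))"
    using assms(3) unfolding UZ_finsler_def by blast+
  have openC: "open (C x)" for x
    using UZ(1) unfolding finsler_metric_function_def by blast
  have F: "in_components E F x y = y $ 3 * U x (f_of Z x y)" if "y \<in> C x" for x y
    using UZ(5)[of "from_components E x y" x] components_from_components[OF assms(1,2), of x y] that
    by (simp add: in_components_def)
  have det: "det (metric_tensor E F x y) = D1 U x (f_of Z x y) * D2 Z x (t_of y)"
    if "y \<in> C x" for x y
    using det_metric_tensor_UZ[where C = "C x" and U = U and Z = Z and x = x and E = E and F = F, OF openC UZ(2-4) F that] .
  define \<Delta>1 \<Delta>2 where "\<Delta>1 x a = D1 U x (f_inv x a)" and "\<Delta>2 x a = D2 Z x (t_inv x a)" for x a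
  have "D1 U x (f_of Z x y) = \<Delta>1 x (theta x (f_of Z x y)) \<and>
      D2 Z x (t_of y) = \<Delta>2 x (phi x (t_of y))" if "y \<in> C x" for x y
    using that by (simp add: \<Delta>1_def \<Delta>2_def assms(4,5))
  with det show ?thesis
    by blast
qed

end
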